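(* Let $k\ge1$ and $d>0$. Let $e$ index a monomial $x^e\in\mathcal T_d(k)$ and put $i=i(e)$. Define $$\varphi_e=(x^e)^*+\sum_{j>i,\ e_j\text{ even},\ e_j>0}(x^{e+\varepsilon_i-\varepsilon_j})^*.$$ If row $e$ of $\overline M(k,d)$ is zero, then $\varphi_e\in K_k(d)$. The functionals $\varphi_e$ obtained from all zero rows $e$ of $\overline M(k,d)$ are linearly independent and include all coordinate spike functionals, i.e. all $(x^b)^*$ with $x^b$ a spike of degree $d$. In particular, with $z(k,d)$ the number of zero rows of $\overline M(k,d)$, $$\dim_{\mathbb F_2}(Q\mathcal P_k)_d\ge z(k,d)\ge\mathcal S_k(d).$$
   Context: $\mathbb N$ includes $0$. $\mathcal P_k=\mathbb F_2[x_1,\dots,x_k]$ with $\deg x_i=1$; $\mathcal P_k^n$ is the degree-$n$ part (zero for $n<0$). For $e\in\mathbb N^k$, $x^e=\prod x_i^{e_i}$, $|e|=\sum e_i$; $\varepsilon_i$ is the $i$th standard vector. The mod-2 Steenrod algebra $\mathcal A$ acts by $\mathrm{Sq}^r(x^a)=\sum_{b\in\mathbb N^k,|b|=r}\prod_i\binom{a_i}{b_i}x^{a+b}$ (mod 2); $\mathcal A^+$ is its augmentation ideal and $Q\mathcal P_k=\mathcal P_k/\mathcal A^+\mathcal P_k$, graded by degree. For $e\neq0$ put $i(e)=\min\{i:e_i>0\}$. The linear map $h$ is given by $h(x^e)=x^{e-\varepsilon_{i(e)}}$ if $e_{i(e)}$ is even, $h(x^e)=0$ if $e_{i(e)}$ is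 odd, and $h(1)=0$. For $d>0$, $p_d=h\,\mathrm{Sq}^1:\mathcal P_k^d\to\mathcal P_k^d$, and $\mathcal T_d(k)$ is the set of degree-$d$ monomials $x^e$ with $e_{i(e)}$ odd; the image of $p_d$ is the span of $\mathcal T_d(k)$. $\overline M(k,d)$ is the matrix with row basis $\mathcal T_d(k)$ and labelled columns $p_d\mathrm{Sq}^{2^t}(g)$ for $t\ge1$, $2^t\le d$, $g$ a monomial of degree $d-2^t$. $\{(x^e)^*\}_{|e|=d}$ is the basis of $(\mathcal P_k^d)^*$ dual to the monomials. $K_k(d)=\bigcap_{r>0}\ker\mathrm{Sq}^r_*\subseteq(\mathcal P_k^d)^*$, where $\mathrm{Sq}^r_*$ is the transpose of $\mathrm{Sq}^r:\mathcal P_k^{d-r}\to\mathcal P_k^d$. A monomial $x^b$ is a spike if each $b_i=2^{m_i}-1$ with $m_i\ge0$ an integer; $\mathcal S_k(d)$ is the number of spikes of degree $d$ in $k$ variables. *)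

theory Defs
  imports Complex_Main "HOL-Library.Z2" "HOL-Library.Poly_Mapping" "HOL-Library.Function_Algebras" "HOL-Library.FuncSet"
begin

abbreviation (input) "lookup \<equiv> Poly_Mapping.lookup"
abbreviation (input) "keys \<equiv> Poly_Mapping.keys"

text \<open>
  The variables \<open>x\<^sub>1, \<dots>, x\<^sub>k\<close> are indexed by an arbitrary finite linearly ordered type \<open>'n\<close>,
  so that \<open>k = CARD('n)\<close> ranges over all integers \<open>\<ge> 1\<close>.  A monomial \<open>x\<^sup>e\<close> is given by its exponent
  \<open>e\<close>, and the polynomial ring over \<open>\<F>\<^sub>2\<close> is the monoid algebra of the exponents over \<^typ>\<open>bit\<close>.
\<close>

type_synonym 'n expo = "'n \<Rightarrow>\<^sub>0 nat"
type_synonym 'n pol = "('n \<Rightarrow>\<^sub>0 nat) \<Rightarrow>\<^sub>0 bit"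

definition deg :: "'n::finite expo \<Rightarrow> nat" where
  "deg e = (\<Sum>i\<in>UNIV. lookup e i)"

definition monomial :: "'n expo \<Rightarrow> 'n pol" where
  "monomial e = Poly_Mapping.single e 1"

definition eps :: "'n \<Rightarrow> 'n expo" where
  "eps i = Poly_Mapping.single i 1"

lemma finite_deg_eq: "finite {e :: 'n::finite expo. deg e = d}"
proof (rule finite_imageD)
  show "finite (lookup ` {e :: 'n expo. deg e = d})"
  proof (rule finite_subset)
    show "lookup ` {e :: 'n expo. deg e = d} \<subseteq> PiE UNIV (\<lambda>_. {..d})"
      by (auto simp: deg_def intro: member_le_sum)
    show "finite (PiE (UNIV :: 'n set) (\<lambda>_. {..d}))"
      by (intro finite_PiE) auto
  qed
  show "inj_on lookup {e :: 'n expo. deg e = d}"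
    by (simp add: inj_on_def)
qed


subsection \<open>Vector spaces over the two-element field\<close>

definition pscale :: "bit \<Rightarrow> 'n pol \<Rightarrow> 'n pol" where
  "pscale c p = Poly_Mapping.map ((*) c) p"

lemma lookup_pscale [simp]: "lookup (pscale c p) e = c * lookup p e"
  by (simp add: pscale_def map.rep_eq when_def)

global_interpretation pol: vector_space "pscale :: bit \<Rightarrow> 'n pol \<Rightarrow> 'n pol"
  by unfold_locales (rule poly_mapping_eqI,
    simp only: lookup_pscale lookup_add distrib_left distrib_right mult.assoc mult_1)+

definition pol_deg :: "nat \<Rightarrow> 'n::finite pol set" where
  "pol_deg d = {p. \<forall>e\<in>keys p. deg e = d}"

definition lin_ext :: "('n expo \<Rightarrow> 'n pol) \<Rightarrow> 'n pol \<Rightarrow> 'n pol" where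
  "lin_ext F p = (\<Sum>e\<in>keys p. pscale (lookup p e) (F e))"


subsection \<open>The Steenrod action and the quotient by the hit polynomials\<close>

definition Sq :: "nat \<Rightarrow> 'n::finite pol \<Rightarrow> 'n pol" where
  "Sq r = lin_ext (\<lambda>a. \<Sum>b\<in>{b. deg b = r}.
     pscale (of_nat (\<Prod>i\<in>UNIV. lookup a i choose lookup b i)) (monomial (a + b)))"

text \<open>
  Only the image of the Steenrod algebra in the endomorphisms of the polynomial ring matters for
  its action.  As the algebra is generated by the squares and its augmentation ideal is the
  two-sided ideal generated by the squares of positive degree, their images are the following two
  sets of operators.
\<close>

inductive_set steenrod :: "('n::finite pol \<Rightarrow> 'n pol) set" where
  one: "id \<in> steenrod"
| Sq: "Sq r \<in> steenrod"
| add: "\<theta> \<in> steenrod \<Longrightarrow> \<eta> \<in> steenrod \<Longrightarrow> (\<lambda>p. \<theta> p + \<eta> p) \<in> steenrod"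
| comp: "\<theta> \<in> steenrod \<Longrightarrow> \<eta> \<in> steenrod \<Longrightarrow> \<theta> \<circ> \<eta> \<in> steenrod"

inductive_set steenrod_plus :: "('n::finite pol \<Rightarrow> 'n pol) set" where
  Sq: "r > 0 \<Longrightarrow> Sq r \<in> steenrod_plus"
| add: "\<theta> \<in> steenrod_plus \<Longrightarrow> \<eta> \<in> steenrod_plus \<Longrightarrow> (\<lambda>p. \<theta> p + \<eta> p) \<in> steenrod_plus"
| left: "\<theta> \<in> steenrod \<Longrightarrow> \<eta> \<in> steenrod_plus \<Longrightarrow> \<theta> \<circ> \<eta> \<in> steenrod_plus"
| right: "\<theta> \<in> steenrod_plus \<Longrightarrow> \<eta> \<in> steenrod \<Longrightarrow> \<theta> \<circ> \<eta> \<in> steenrod_plus"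

definition hit :: "'n::finite pol set" where
  "hit = pol.span {\<theta> p | \<theta> p. \<theta> \<in> steenrod_plus}"

quotient_type (overloaded) 'n QP = "'n::finite pol" / "\<lambda>p q. p - q \<in> (hit :: 'n pol set)"
  morphisms rep_QP QP_class
proof (rule equivpI)
  show "reflp (\<lambda>p q. p - q \<in> (hit :: 'n pol set))"
    by (auto simp: reflp_def hit_def pol.span_zero)
  show "symp (\<lambda>p q. p - q \<in> (hit :: 'n pol set))"
    unfolding symp_def hit_def
  proof (intro allI impI)
    fix p q :: "'n pol"
    let ?H = "pol.span {\<theta> p | \<theta> p. \<theta> \<in> (steenrod_plus :: ('n pol \<Rightarrow> 'n pol) set)}"
    assume "p - q \<in> ?H"
    from pol.span_neg[OF this] show "q - p \<in> ?H" by simp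
  qed
  show "transp (\<lambda>p q. p - q \<in> (hit :: 'n pol set))"
    unfolding transp_def hit_def
  proof (intro allI impI)
    fix p q r :: "'n pol"
    let ?H = "pol.span {\<theta> p | \<theta> p. \<theta> \<in> (steenrod_plus :: ('n pol \<Rightarrow> 'n pol) set)}"
    assume "p - q \<in> ?H" "q - r \<in> ?H"
    from pol.span_add[OF this] show "p - r \<in> ?H" by simp
  qed
qed

instantiation QP :: (finite) ab_group_add
begin

lift_definition zero_QP :: "'a QP" is 0 .

lift_definition plus_QP :: "'a QP \<Rightarrow> 'a QP \<Rightarrow> 'a QP" is "(+)"
  unfolding hit_def by (simp only: add_diff_add pol.span_add)

lift_definition uminus_QP :: "'a QP \<Rightarrow> 'a QP" is uminus
  unfolding hit_def by (simp only: minus_diff_minus pol.span_neg)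

lift_definition minus_QP :: "'a QP \<Rightarrow> 'a QP \<Rightarrow> 'a QP" is "(-)"
proof -
  fix p p' q q' :: "'a pol"
  assume "p - p' \<in> hit" "q - q' \<in> hit"
  then have "(p - p') - (q - q') \<in> hit"
    unfolding hit_def by (rule pol.span_diff)
  then show "(p - q) - (p' - q') \<in> hit"
    by (simp add: algebra_simps)
qed

instance
proof
  have eq: "p - q \<in> hit" if "p = q" for p q :: "'a pol"
    using that by (simp add: hit_def pol.span_zero)
  fix a b c :: "'a QP"
  show "a + b + c = a + (b + c)" by transfer (rule eq, rule add.assoc)
  show "a + b = b + a" by transfer (rule eq, rule add.commute)
  show "0 + a = a" by transfer (rule eq, rule add_0)
  show "- a + a = 0" by transfer (rule eq, rule left_minus)
  show "a - b = a + - b" by transfer (rule eq, rule diff_conv_add_uminus)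
qed

end

lift_definition qscale :: "bit \<Rightarrow> 'n::finite QP \<Rightarrow> 'n QP" is pscale
  unfolding hit_def by (simp only: pol.scale_right_diff_distrib[symmetric] pol.span_scale)

global_interpretation QP: vector_space "qscale :: bit \<Rightarrow> 'n::finite QP \<Rightarrow> 'n QP"
  by (unfold_locales; transfer)
    (simp_all only: pol.scale_right_distrib pol.scale_left_distrib pol.scale_scale pol.scale_one
      diff_self hit_def pol.span_zero)

definition QP_deg :: "nat \<Rightarrow> 'n::finite QP set" where
  "QP_deg d = QP_class ` pol_deg d"


subsection \<open>The matrix\<close>

definition lead :: "'n::{finite,linorder} expo \<Rightarrow> 'n" where
  "lead e = Min {i. lookup e i > 0}"

definition hmap :: "'n::{finite,linorder} pol \<Rightarrow> 'n pol" where
  "hmap = lin_ext (\<lambda>e.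
     if e \<noteq> 0 \<and> even (lookup e (lead e)) then monomial (e - eps (lead e)) else 0)"

text \<open>On \<^term>\<open>pol_deg d\<close> with \<open>d > 0\<close> this is the map \<open>p\<^sub>d\<close>.\<close>

definition hSq1 :: "'n::{finite,linorder} pol \<Rightarrow> 'n pol" where
  "hSq1 p = hmap (Sq 1 p)"

definition rows :: "nat \<Rightarrow> 'n::{finite,linorder} expo set" where
  "rows d = {e. deg e = d \<and> e \<noteq> 0 \<and> odd (lookup e (lead e))}"

definition columns :: "nat \<Rightarrow> (nat \<times> 'n::finite expo) set" where
  "columns d = {(t, g). 1 \<le> t \<and> 2 ^ t \<le> d \<and> deg g = d - 2 ^ t}"

text \<open>
  As the column vectors lie in the span of the monomials indexed by \<^const>\<open>rows\<close>, their coordinates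
  in that basis are their coefficients.
\<close>

definition Mbar :: "'n::{finite,linorder} expo \<Rightarrow> nat \<times> 'n expo \<Rightarrow> bit" where
  "Mbar e = (\<lambda>(t, g). lookup (hSq1 (Sq (2 ^ t) (monomial g))) e)"

definition zero_rows :: "nat \<Rightarrow> 'n::{finite,linorder} expo set" where
  "zero_rows d = {e \<in> rows d. \<forall>c\<in>columns d. Mbar e c = 0}"


subsection \<open>The dual space\<close>

definition fscale :: "bit \<Rightarrow> ('n pol \<Rightarrow> bit) \<Rightarrow> ('n pol \<Rightarrow> bit)" where
  "fscale c f = (\<lambda>p. c * f p)"

global_interpretation fun_pol: vector_space "fscale :: bit \<Rightarrow> ('n pol \<Rightarrow> bit) \<Rightarrow> _"
  by unfold_locales
    (simp_all only: fscale_def fun_eq_iff plus_fun_apply distrib_left distrib_right mult.assoc mult_1 simp_thms)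

text \<open>
  A functional on the degree \<open>d\<close> part is represented by its extension by zero to the other degrees.
  Under this identification the transpose of \<^term>\<open>Sq r\<close> is composition with \<^term>\<open>Sq r\<close>, since
  \<^term>\<open>Sq r\<close> raises degrees by exactly \<open>r\<close>.
\<close>

definition dual_deg :: "nat \<Rightarrow> ('n::finite pol \<Rightarrow> bit) set" where
  "dual_deg d = {f. Vector_Spaces.linear pscale (*) f \<and> (\<forall>n p. n \<noteq> d \<longrightarrow> p \<in> pol_deg n \<longrightarrow> f p = 0)}"

definition Sq_dual :: "nat \<Rightarrow> ('n::finite pol \<Rightarrow> bit) \<Rightarrow> ('n pol \<Rightarrow> bit)" where
  "Sq_dual r f = f \<circ> Sq r"

definition Sq_kernel :: "nat \<Rightarrow> ('n::finite pol \<Rightarrow> bit) set" where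
  "Sq_kernel d = {f \<in> dual_deg d. \<forall>r>0. Sq_dual r f = 0}"

definition dual_mon :: "'n expo \<Rightarrow> 'n pol \<Rightarrow> bit" where
  "dual_mon e p = lookup p e"

definition phi :: "'n::{finite,linorder} expo \<Rightarrow> 'n pol \<Rightarrow> bit" where
  "phi e = dual_mon e +
     (\<Sum>j\<in>{j. lead e < j \<and> even (lookup e j) \<and> lookup e j > 0}.
       dual_mon (e + eps (lead e) - eps j))"

definition spikes :: "nat \<Rightarrow> 'n::finite expo set" where
  "spikes d = {b. deg b = d \<and> (\<forall>i. \<exists>m. lookup b i = 2 ^ m - 1)}"

end

theory Submission
  imports Defs "HOL-Computational_Algebra.Polynomial"
begin

text \<open>
  The coefficient of \<open>x\<^sup>e\<close> in \<open>h(q)\<close>, for a row \<open>e\<close> with leading variable \<open>i\<close>, is the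
  coefficient of \<open>x\<^bsup>e+\<epsilon>\<^sub>i\<^esup>\<close> in \<open>q\<close>.  Reading off this coefficient of \<open>Sq\<^sup>1(p)\<close> gives exactly
  \<open>\<phi>\<^sub>e(p)\<close>: a monomial \<open>x\<^sup>a\<close> contributes when \<open>a = e + \<epsilon>\<^sub>i - \<epsilon>\<^sub>j\<close> with \<open>a\<^sub>j\<close> odd
  (\<open>phi_eq_coeff_Sq_1\<close>, \<open>coeff_hmap\<close>).  So the entries of row \<open>e\<close> are the values of \<open>\<phi>\<^sub>e\<close> on
  the polynomials \<open>Sq\<^bsup>2^t\<^esup>(g)\<close> with \<open>t \<ge> 1\<close>, and a zero row means that \<open>\<phi>\<^sub>e\<close> kills the images
  of these squares.  It kills the image of \<open>Sq\<^sup>1\<close> in any case, because \<open>Sq\<^sup>1Sq\<^sup>1 = 0\<close>.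

  It remains to pass from the squares \<open>Sq\<^bsup>2^t\<^esup>\<close> to all squares, that is, to use that the other
  squares are decomposable.  Instead of the Adem relations the proof uses the equivalent identity of
  Bullett and Macdonald: with \<open>P(u) = \<Sum>\<^sub>i u\<^sup>i Sq\<^sup>i\<close>, the composite \<open>P(u)P(v)\<close> depends only on
  \<open>u + v\<close> and \<open>u\<^sup>2v\<close>, since it is multiplicative and sends a variable \<open>x\<close> to
  \<open>x + (u+v)x\<^sup>2 + u\<^sup>2v x\<^sup>4\<close>.  Hence \<open>P(s\<^sup>2+s)P(1) = P(1+s)P(s\<^sup>2)\<close>.  If a functional \<open>f\<close> kills the
  images of \<open>Sq\<^sup>i\<close> for \<open>0 < i < r\<close>, then in the part of degree \<open>r\<close> only the outermost terms
  survive, and they give \<open>f Sq\<^sup>r \<cdot> (1 + (s\<^sup>2+s)\<^sup>r) = f Sq\<^sup>r \<cdot> (s\<^bsup>2r\<^esup> + (1+s)\<^sup>r)\<close>.  For \<open>0 < k < r\<close> the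
  coefficient of \<open>s\<^sup>k\<close> is \<open>0\<close> on the left and \<open>(r choose k) f Sq\<^sup>r\<close> on the right.  Some such
  binomial coefficient is odd unless \<open>r\<close> is a power of two, so \<open>f Sq\<^sup>r = 0\<close> (\<open>Sq_decomposable\<close>).

  Rows are dual to the functionals: \<open>\<phi>\<^sub>e(x\<^bsup>e'\<^esup>)\<close> is the Kronecker delta for rows \<open>e, e'\<close>, as each
  further exponent in \<open>\<phi>\<^sub>e\<close> has an even leading entry (\<open>phi_row_monomial\<close>).  This gives the
  independence of the \<open>\<phi>\<^sub>e\<close>.  Functionals killed by all \<open>Sq\<^sup>r\<^sub>*\<close> vanish on the hit polynomials,
  so the same duality shows that the classes of the monomials \<open>x\<^sup>e\<close>, for zero rows \<open>e\<close>, are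
  independent in the quotient, which yields the bound on the dimension.

  For a spike \<open>b\<close> no positive exponent is even, so \<open>\<phi>\<^sub>b = (x\<^sup>b)\<^sup>*\<close>, and \<open>x\<^sup>b\<close> occurs in no \<open>Sq\<^sup>r(x\<^sup>g)\<close>
  with \<open>r > 0\<close>, because \<open>n choose c\<close> is even whenever \<open>n + c = 2\<^sup>m - 1\<close> and \<open>c > 0\<close>.
\<close>

(* These rules turn arithmetic of bits into bitwise operations, where the laws of a field no longer
   match. *)
declare add_bit_eq_xor [simp del] mult_bit_eq_and [simp del]

section \<open>Binomial coefficients modulo two\<close>

lemma even_choose_double:
  "even ((2 * n) choose (Suc (2 * k)))" "even ((2 * n) choose (2 * k)) = even (n choose k)"
proof (induction n arbitrary: k)
  case (Suc n)
  {
    case 1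
    show ?case
      by (cases k) (use Suc.IH(1)[of k] Suc.IH(1)[of "k - 1"] in auto)
  next
    case 2
    show ?case
      using Suc.IH(1)[of "k - 1"] Suc.IH(2)[of k] Suc.IH(2)[of "k - 1"] by (cases k) auto
  }
next
  case 0
  { case 1 show ?case by simp next case 2 show ?case by (cases k) auto }
qed

lemma even_choose_Suc_double: "even (Suc (2 * n) choose (2 * k)) = even (n choose k)"
  using even_choose_double(1)[of n "k - 1"] even_choose_double(2)[of n k] by (cases k) auto

text \<open>
  If \<open>n choose c\<close> is odd then \<open>n\<close> has the binary digit one wherever \<open>c\<close> has it, so the lowest such
  place of \<open>c\<close> produces a carry, and \<open>n + c\<close> has a zero there below a nonzero digit.  The induction
  strips the digits below this place, which are ones in \<open>n\<close> and zeros in \<open>c\<close>.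
\<close>
lemma even_choose_if_add_eq_mersenne:
  assumes "n + c = 2 ^ m - 1" and "c > 0"
  shows "even (n choose c)"
  using assms
proof (induction m arbitrary: n c)
  case (Suc m)
  have "odd (n + c)"
    using Suc.prems by simp
  show ?case
  proof (cases "even c")
    case True
    then obtain c' n' where "c = 2 * c'" "n = Suc (2 * n')"
      using \<open>odd (n + c)\<close> by (auto elim!: evenE oddE)
    with Suc.prems Suc.IH[of n' c'] show ?thesis
      by (simp only: even_choose_Suc_double) auto
  next
    case False
    then obtain c' n' where "c = Suc (2 * c')" "n = 2 * n'"
      using \<open>odd (n + c)\<close> by (auto elim!: evenE oddE)
    then show ?thesis
      by (simp only: even_choose_double)
  qed
qed simp

text \<open>
  Halve \<open>r\<close> as long as it is even, which halves the lower index too; at an odd number greater than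
  one, the lower index \<open>1\<close> works.
\<close>
lemma odd_choose_if_not_power_of_two:
  assumes "r > 0" and "\<nexists>t. r = 2 ^ t"
  obtains a where "0 < a" "a < r" "odd (r choose a)"
proof -
  have "\<exists>a. 0 < a \<and> a < r \<and> odd (r choose a)"
    using assms
  proof (induction r rule: less_induct)
    case (less r)
    show ?case
    proof (cases "even r")
      case True
      then obtain q where q: "r = 2 * q" by (elim evenE)
      have "\<nexists>t. q = 2 ^ t"
        using less.prems(2) q by (metis power_Suc)
      then obtain a where "0 < a" "a < q" "odd (q choose a)"
        using less.IH[of q] less.prems(1) q by auto
      then show ?thesis
        using q by (intro exI[of _ "2 * a"]) (simp add: even_choose_double)
    next
      case False
      have "r \<noteq> 1"
        using less.prems(2) by (metis power_0)
      then show ?thesis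
        using False less.prems(1) by (intro exI[of _ 1]) auto
    qed
  qed
  then show thesis
    using that by blast
qed


section \<open>The generating function of an iterated square in one variable\<close>

lemma coeff_one_plus_linear_power:
  fixes u :: "'r::comm_ring_1"
  shows "coeff ([:1, u:] ^ n) c = of_nat (n choose c) * u ^ c"
proof (induction n arbitrary: c)
  case 0
  show ?case by (cases c) auto
next
  case (Suc n)
  have "[:1, u:] ^ Suc n = [:1, u:] ^ n + pCons 0 (smult u ([:1, u:] ^ n))"
    by simp
  then show ?case
    by (cases c) (simp_all only: coeff_add Suc.IH coeff_pCons_0 coeff_pCons_Suc coeff_smult
        choose_reduce_nat binomial_n_0 binomial_Suc_Suc of_nat_add, simp_all add: algebra_simps)
qed

text \<open>
  This is the coefficient of \<open>x\<^bsup>a+w\<^esup>\<close> in \<open>P(u)P(v)(x\<^sup>a)\<close> for one variable \<open>x\<close>: the inner operation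
  raises the exponent by \<open>b\<close>, the outer one by \<open>w - b\<close>.
\<close>
definition bm_coeff :: "'r::comm_ring_1 \<Rightarrow> 'r \<Rightarrow> nat \<Rightarrow> nat \<Rightarrow> 'r" where
  "bm_coeff u v a w =
     (\<Sum>b\<le>w. of_nat ((a choose b) * (a + b choose (w - b))) * (u ^ (w - b) * v ^ b))"

text \<open>
  The inner sum over the outer square is a coefficient of \<open>(1 + uX)\<^bsup>a+b\<^esup>\<close>, so the double sum
  collapses to \<open>((1 + uX)(1 + vX(1 + uX)))\<^sup>a\<close>.  In characteristic two the quadratic term of the base,
  \<open>2uv X\<^sup>2\<close>, disappears, and only the symmetric expressions \<open>u + v\<close> and \<open>u\<^sup>2v\<close> remain.
\<close>
lemma bm_coeff_eq:
  fixes u v :: "'r::comm_ring_1"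
  assumes "(2 :: 'r) = 0"
  shows "bm_coeff u v a w = coeff ([:1, u + v, 0, u\<^sup>2 * v:] ^ a) w"
proof -
  have dbl: "x + x = 0" for x :: 'r
    using assms by (metis mult_2 mult_zero_left)
  have "[:1, u + v, 0, u\<^sup>2 * v:] = [:1, u:] * (monom v 1 * [:1, u:] + 1)"
    using dbl by (simp add: monom_altdef power2_eq_square algebra_simps one_pCons)
  then have "[:1, u + v, 0, u\<^sup>2 * v:] ^ a = [:1, u:] ^ a * (monom v 1 * [:1, u:] + 1) ^ a"
    by (simp only: power_mult_distrib)
  also have "(monom v 1 * [:1, u:] + 1) ^ a =
      (\<Sum>b\<le>a. of_nat (a choose b) * (monom (v ^ b) b * [:1, u:] ^ b))"
    by (simp only: binomial_ring power_mult_distrib monom_power power_one mult_1_right mult_1)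
  also have "[:1, u:] ^ a * \<dots> =
      (\<Sum>b\<le>a. monom (v ^ b) b * (of_nat (a choose b) * [:1, u:] ^ (a + b)))"
    by (simp add: sum_distrib_left power_add algebra_simps)
  finally have "coeff ([:1, u + v, 0, u\<^sup>2 * v:] ^ a) w =
      (\<Sum>b\<le>a. if w < b then 0 else
        v ^ b * (of_nat (a choose b) * (of_nat (a + b choose (w - b)) * u ^ (w - b))))"
    by (simp add: coeff_sum coeff_monom_mult of_nat_poly coeff_one_plus_linear_power
        algebra_simps if_distrib[of "(*) _"] cong: if_cong)
  also have "\<dots> = (\<Sum>b\<in>{..a} \<inter> {..w}. of_nat ((a choose b) * (a + b choose (w - b))) * (u ^ (w - b) * v ^ b))"
    by (intro sum.mono_neutral_cong_right) (auto simp: algebra_simps)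
  also have "\<dots> = bm_coeff u v a w"
    unfolding bm_coeff_def
  proof (intro sum.mono_neutral_left ballI)
    fix b assume "b \<in> {..w} - {..a} \<inter> {..w}"
    then have "a < b"
      by auto
    then show "of_nat ((a choose b) * (a + b choose (w - b))) * (u ^ (w - b) * v ^ b) = 0"
      by (simp add: binomial_eq_0)
  qed auto
  finally show ?thesis ..
qed


section \<open>Linear maps on polynomials\<close>

lemma bit_of_nat_even: "even n \<Longrightarrow> (of_nat n :: bit) = 0"
  and bit_of_nat_odd: "odd n \<Longrightarrow> (of_nat n :: bit) = 1"
  by (auto elim!: evenE oddE simp: mult_2)

abbreviation functional :: "('n pol \<Rightarrow> bit) \<Rightarrow> bool" where
  "functional \<equiv> Vector_Spaces.linear pscale (*)"

lemma pol_eq_sum_monomials: "p = (\<Sum>a\<in>keys p. pscale (lookup p a) (monomial a))"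
  by (rule poly_mapping_eqI)
    (simp add: lookup_sum monomial_def lookup_single when_def if_distrib[of "(*) _"] sum.delta'
      in_keys_iff cong: if_cong)

lemma linear_expand:
  assumes "Vector_Spaces.linear pscale s f"
  shows "f p = (\<Sum>a\<in>keys p. s (lookup p a) (f (monomial a)))"
proof -
  interpret Vector_Spaces.linear pscale s f by fact
  show ?thesis
    by (subst pol_eq_sum_monomials) (simp only: sum scale)
qed

lemma linear_eqI:
  assumes "Vector_Spaces.linear pscale s f" and "Vector_Spaces.linear pscale s g"
    and "\<And>a. f (monomial a) = g (monomial a)"
  shows "f = g"
proof
  fix p
  show "f p = g p"
    using linear_expand[OF assms(1), of p] linear_expand[OF assms(2), of p] by (simp add: assms(3))
qed

lemma lin_ext_superset:
  assumes "finite A" and "keys p \<subseteq> A"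
  shows "lin_ext F p = (\<Sum>e\<in>A. pscale (lookup p e) (F e))"
  unfolding lin_ext_def using assms
  by (intro sum.mono_neutral_left) (auto simp: in_keys_iff)

lemma linear_lin_ext: "Vector_Spaces.linear pscale pscale (lin_ext F)"
  unfolding Vector_Spaces.linear_iff
proof (intro conjI allI)
  fix p q :: "'a pol" and c :: bit
  let ?A = "keys p \<union> keys q"
  have "lin_ext F (p + q) = (\<Sum>e\<in>?A. pscale (lookup (p + q) e) (F e))"
    by (rule lin_ext_superset) (auto simp: Poly_Mapping.keys_add)
  also have "\<dots> = lin_ext F p + lin_ext F q"
    by (simp add: lookup_add pol.scale_left_distrib sum.distrib lin_ext_superset[of ?A])
  finally show "lin_ext F (p + q) = lin_ext F p + lin_ext F q" .
  have "lin_ext F (pscale c p) = (\<Sum>e\<in>keys p. pscale (lookup (pscale c p) e) (F e))"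
    by (rule lin_ext_superset) (auto simp: in_keys_iff)
  then show "lin_ext F (pscale c p) = pscale c (lin_ext F p)"
    by (simp add: lin_ext_def pol.scale_sum_right)
qed (rule pol.vector_space_axioms)+

lemma lin_ext_monomial: "lin_ext F (monomial a) = F a"
  by (simp add: lin_ext_def monomial_def)

lemma linear_Sq: "Vector_Spaces.linear pscale pscale (Sq r)"
  unfolding Sq_def by (rule linear_lin_ext)

lemma functional_Sq: "functional f \<Longrightarrow> functional (f \<circ> Sq r)"
  by (rule Vector_Spaces.linear_compose[OF linear_Sq])

lemma vector_space_bit: "vector_space ((*) :: bit \<Rightarrow> bit \<Rightarrow> bit)"
  by unfold_locales (simp_all only: distrib_left distrib_right mult.assoc mult_1)

lemma functional_dual_mon: "functional (dual_mon e)"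
  unfolding Vector_Spaces.linear_iff
  by (intro conjI pol.vector_space_axioms vector_space_bit) (simp_all add: dual_mon_def lookup_add)

lemma dual_mon_monomial: "dual_mon e (monomial a) = of_bool (a = e)"
  by (simp add: dual_mon_def monomial_def lookup_single when_def)


section \<open>The Bullett--Macdonald identity\<close>

lemma deg_add: "deg (a + b) = deg a + deg b"
  by (simp add: deg_def lookup_add sum.distrib)

lemma deg_eq_0_iff: "deg e = 0 \<longleftrightarrow> e = 0"
  by (auto simp: deg_def intro: poly_mapping_eqI)

definition mbinom :: "'n::finite expo \<Rightarrow> 'n expo \<Rightarrow> nat" where
  "mbinom a b = (\<Prod>i\<in>UNIV. lookup a i choose lookup b i)"

lemma Sq_monomial:
  "Sq r (monomial a) = (\<Sum>b\<in>{b. deg b = r}. pscale (of_nat (mbinom a b)) (monomial (a + b)))"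
  by (simp add: Sq_def lin_ext_monomial mbinom_def)

lemma functional_Sq_monomial:
  assumes "functional f"
  shows "f (Sq r (monomial a)) = (\<Sum>b\<in>{b. deg b = r}. of_nat (mbinom a b) * f (monomial (a + b)))"
proof -
  interpret Vector_Spaces.linear pscale "(*)" f by fact
  show ?thesis
    by (simp only: Sq_monomial sum scale)
qed

lemma Sq_0: "Sq 0 p = p"
proof -
  have "Sq 0 = (id :: 'a pol \<Rightarrow> _)"
    by (rule linear_eqI[OF linear_Sq pol.linear_id])
      (simp add: Sq_monomial deg_eq_0_iff mbinom_def)
  then show ?thesis by simp
qed

text \<open>
  Expanding the product chooses, for each variable, how \<open>w\<^sub>i\<close> splits between the two operations;
  together the choices form a decomposition \<open>w = b + c\<close> of exponents.
\<close>
lemma prod_bm_coeff: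
  fixes a w :: "'n::finite expo" and u v :: "'r::comm_ring_1"
  shows "(\<Prod>i\<in>UNIV. bm_coeff u v (lookup a i) (lookup w i)) =
    (\<Sum>(b, c)\<in>{(b, c). b + c = w}. of_nat (mbinom a b * mbinom (a + b) c) * (u ^ deg c * v ^ deg b))"
proof -
  let ?t = "\<lambda>i b. of_nat ((lookup a i choose b) * (lookup a i + b choose (lookup w i - b))) *
    (u ^ (lookup w i - b) * v ^ b)"
  have "(\<Prod>i\<in>UNIV. bm_coeff u v (lookup a i) (lookup w i)) =
      (\<Sum>g\<in>PiE UNIV (\<lambda>i. {..lookup w i}). \<Prod>i\<in>UNIV. ?t i (g i))"
    unfolding bm_coeff_def by (rule prod_sum_PiE) auto
  also have "\<dots> = (\<Sum>(b, c)\<in>{(b, c). b + c = w}. \<Prod>i\<in>UNIV. ?t i (lookup b i))"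
  proof (rule sum.reindex_bij_witness[where i = "\<lambda>(b, c). lookup b"
        and j = "\<lambda>g. (Abs_poly_mapping g, w - Abs_poly_mapping g)"])
    fix g assume "g \<in> (\<Pi>\<^sub>E i\<in>UNIV. {..lookup w i})"
    then have "g i \<le> lookup w i" for i
      by (auto dest: PiE_mem)
    then have "Abs_poly_mapping g + (w - Abs_poly_mapping g) = w"
      by (intro poly_mapping_eqI) (simp add: lookup_add lookup_minus)
    then show "(Abs_poly_mapping g, w - Abs_poly_mapping g) \<in> {(b, c). b + c = w}"
      by simp
  next
    fix x :: "'n expo \<times> 'n expo" assume "x \<in> {(b, c). b + c = w}"
    then obtain b c where x: "x = (b, c)" and w: "w = b + c" by auto
    show "(case x of (b, c) \<Rightarrow> lookup b) \<in> (\<Pi>\<^sub>E i\<in>UNIV. {..lookup w i})"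
      by (auto simp: x w lookup_add)
    show "(Abs_poly_mapping (case x of (b, c) \<Rightarrow> lookup b),
        w - Abs_poly_mapping (case x of (b, c) \<Rightarrow> lookup b)) = x"
      by (simp add: x w)
  qed simp_all
  also have "\<dots> = (\<Sum>(b, c)\<in>{(b, c). b + c = w}.
      of_nat (mbinom a b * mbinom (a + b) c) * (u ^ deg c * v ^ deg b))"
    by (intro sum.cong) (auto simp: mbinom_def deg_def lookup_add prod.distrib power_sum)
  finally show ?thesis .
qed

lemma smult_sum_right: "smult c (\<Sum>x\<in>A. p x) = (\<Sum>x\<in>A. smult c (p x))"
  using sum_distrib_left[of "[:c:]" p A] by simp

text \<open>
  The left-hand side is the part of \<open>f \<circ> P(u)P(v)\<close> raising degrees by \<open>r\<close>.  Sorting its terms by the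
  total increase \<open>w\<close> of the exponent, rather than by the degree of the inner square, makes them
  products over the variables.
\<close>
lemma sum_iterated_Sq:
  fixes a :: "'n::finite expo" and u v :: "bit poly"
  assumes f: "functional f"
  shows "(\<Sum>j\<le>r. smult (f (Sq (r - j) (Sq j (monomial a)))) (u ^ (r - j) * v ^ j)) =
    (\<Sum>w\<in>{w. deg w = r}. smult (f (monomial (a + w)))
      (\<Prod>i\<in>UNIV. bm_coeff u v (lookup a i) (lookup w i)))"
proof -
  define H where "H = (\<lambda>(b, c). smult (of_nat (mbinom a b * mbinom (a + b) c) * f (monomial (a + b + c)))
    (u ^ deg c * v ^ deg b))"
  define S where "S = {(b :: 'n expo, c :: 'n expo). deg b + deg c = r}"
  have "S \<subseteq> (\<Union>i\<le>r. {b. deg b = i}) \<times> (\<Union>i\<le>r. {b. deg b = i})"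
    by (auto simp: S_def)
  then have fin: "finite S"
    by (rule finite_subset) (auto simp: finite_deg_eq)
  have "(\<Sum>j\<le>r. smult (f (Sq (r - j) (Sq j (monomial a)))) (u ^ (r - j) * v ^ j)) =
      (\<Sum>j\<le>r. \<Sum>x\<in>{x \<in> S. deg (fst x) = j}. H x)"
  proof (rule sum.cong[OF refl])
    fix j assume "j \<in> {..r}"
    then have S: "{x \<in> S. deg (fst x) = j} = {b. deg b = j} \<times> {c. deg c = r - j}"
      by (auto simp: S_def)
    have "f (Sq (r - j) (Sq j (monomial a))) = (\<Sum>b\<in>{b. deg b = j}. \<Sum>c\<in>{c. deg c = r - j}.
        of_nat (mbinom a b * mbinom (a + b) c) * f (monomial (a + b + c)))"
      using functional_Sq_monomial[OF functional_Sq[OF f], of "r - j" j a]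
      by (simp add: functional_Sq_monomial[OF f] sum_distrib_left mult.assoc)
    then show "smult (f (Sq (r - j) (Sq j (monomial a)))) (u ^ (r - j) * v ^ j) =
        (\<Sum>x\<in>{x \<in> S. deg (fst x) = j}. H x)"
      by (simp add: S H_def smult_sum sum.cartesian_product[symmetric])
  qed
  also have "\<dots> = sum H S"
    using fin by (intro sum.group) (auto simp: S_def)
  also have "\<dots> = (\<Sum>w\<in>{w. deg w = r}. \<Sum>x\<in>{x \<in> S. fst x + snd x = w}. H x)"
  proof (rule sum.group[symmetric])
    show "(\<lambda>x. fst x + snd x) ` S \<subseteq> {w. deg w = r}"
      by (auto simp: S_def deg_add)
  qed (fact fin finite_deg_eq)+
  also have "\<dots> = (\<Sum>w\<in>{w. deg w = r}. smult (f (monomial (a + w)))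
      (\<Prod>i\<in>UNIV. bm_coeff u v (lookup a i) (lookup w i)))"
  proof (rule sum.cong[OF refl])
    fix w :: "'n expo" assume "w \<in> {w. deg w = r}"
    then have "deg w = r"
      by simp
    then have S: "{x \<in> S. fst x + snd x = w} = {(b, c). b + c = w}"
    proof (intro set_eqI iffI)
      fix x assume "x \<in> {(b, c). b + c = w}"
      then have "fst x + snd x = w"
        by auto
      moreover from this have "deg (fst x) + deg (snd x) = r"
        using \<open>deg w = r\<close> by (metis deg_add)
      ultimately show "x \<in> {x \<in> S. fst x + snd x = w}"
        by (simp add: S_def split_beta)
    qed (simp add: split_beta)
    have "smult (f (monomial (a + w))) (\<Prod>i\<in>UNIV. bm_coeff u v (lookup a i) (lookup w i)) =
       (\<Sum>x\<in>{(b, c). b + c = w}. smult (f (monomial (a + w)))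
         (case x of (b, c) \<Rightarrow> of_nat (mbinom a b * mbinom (a + b) c) * (u ^ deg c * v ^ deg b)))"
      unfolding prod_bm_coeff by (rule smult_sum_right)
    also have "\<dots> = (\<Sum>x\<in>{x \<in> S. fst x + snd x = w}. H x)"
      unfolding S by (intro sum.cong refl) (auto simp: H_def of_nat_poly add.assoc mult.commute)
    finally show "(\<Sum>x\<in>{x \<in> S. fst x + snd x = w}. H x) = smult (f (monomial (a + w)))
      (\<Prod>i\<in>UNIV. bm_coeff u v (lookup a i) (lookup w i))" ..
  qed
  finally show ?thesis .
qed

lemma bit_poly_double: "p + p = (0 :: bit poly)"
  by (rule poly_eqI) (simp only: coeff_add coeff_0, simp only: mult_2[symmetric] bit_2_eq_0 mult_zero_left)

lemma bullett_macdonald: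
  fixes u v u' v' :: "bit poly"
  assumes "functional f" and "u + v = u' + v'" and "u\<^sup>2 * v = u'\<^sup>2 * v'"
  shows "(\<Sum>j\<le>r. smult (f (Sq (r - j) (Sq j (monomial a)))) (u ^ (r - j) * v ^ j)) =
    (\<Sum>j\<le>r. smult (f (Sq (r - j) (Sq j (monomial a)))) (u' ^ (r - j) * v' ^ j))"
proof -
  have "(2 :: bit poly) = 0"
    using bit_poly_double[of 1] by simp
  then show ?thesis
    using assms by (simp only: sum_iterated_Sq bm_coeff_eq)
qed

text \<open>
  This substitution makes both pairs have sum \<open>s\<^sup>2 + s + 1\<close> and the same \<open>u\<^sup>2v = s\<^sup>2(s+1)\<^sup>2\<close>.
\<close>
lemma bullett_macdonald_one_variable:
  fixes s :: "bit poly"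
  assumes "functional f"
  shows "(\<Sum>j\<le>r. smult (f (Sq (r - j) (Sq j (monomial a)))) ((s\<^sup>2 + s) ^ (r - j) * 1 ^ j)) =
    (\<Sum>j\<le>r. smult (f (Sq (r - j) (Sq j (monomial a)))) ((1 + s) ^ (r - j) * (s\<^sup>2) ^ j))"
  by (rule bullett_macdonald[OF assms]) (simp_all add: power2_eq_square algebra_simps)


text \<open>
  In the part of degree \<open>2\<close> of the identity, the coefficient of \<open>s\<close> is \<open>f Sq\<^sup>1Sq\<^sup>1\<close> on the left and
  \<open>0\<close> on the right.
\<close>
lemma Sq_1_Sq_1:
  assumes "functional f"
  shows "f (Sq 1 (Sq 1 (monomial a))) = 0"
proof -
  define s :: "bit poly" where "s = [:0, 1:]"
  (* The weights with which Sq^2 Sq^0, Sq^1 Sq^1 and Sq^0 Sq^2 enter the coefficient of s on the two sides. *)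
  have coeffs: "coeff ((s\<^sup>2 + s) ^ 2) 1 = 0" "coeff (s\<^sup>2) 1 = 0" "coeff s 1 = 1"
    "coeff ((1 + s) ^ 2) 1 = 0"
    "coeff ((1 + s) * s\<^sup>2) 1 = 0" "coeff ((s\<^sup>2)\<^sup>2) 1 = 0"
    by (simp_all add: s_def power2_eq_square one_pCons)
  have sum3: "(\<Sum>j\<le>2. c j) = c 0 + c 1 + c 2" for c :: "nat \<Rightarrow> bit poly"
    by (simp add: numeral_2_eq_2)
  have diffs: "2 - 0 = (2 :: nat)" "2 - 1 = (1 :: nat)" "2 - 2 = (0 :: nat)"
    by simp_all
  show ?thesis
    using arg_cong[OF bullett_macdonald_one_variable[OF assms, of 2 a s], of "\<lambda>p. coeff p 1"]
    by (simp only: sum3 diffs power_0 power_one_right power_one coeff_add coeff_smult coeffs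
        mult_1 mult_1_right coeff_1 mult_zero_right add_0 add_0_right) simp
qed

text \<open>
  The dual form of the decomposability of \<open>Sq\<^sup>r\<close>: all terms \<open>Sq\<^sup>iSq\<^sup>j\<close> with \<open>i + j = r\<close> and
  \<open>0 < i < r\<close> are invisible to \<open>f\<close>, and comparing the coefficients of \<open>s\<^sup>k\<close> with \<open>r choose k\<close> odd
  isolates \<open>f Sq\<^sup>r\<close>.
\<close>
lemma Sq_decomposable:
  assumes f: "functional f" and "r > 0" and "\<nexists>t. r = 2 ^ t"
    and lower: "\<And>i p. 0 < i \<Longrightarrow> i < r \<Longrightarrow> f (Sq i p) = 0"
  shows "f (Sq r (monomial a)) = 0"
proof -
  obtain k where k: "0 < k" "k < r" "odd (r choose k)"
    using odd_choose_if_not_power_of_two assms(2,3) by blast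
  define s :: "bit poly" where "s = monom 1 1"
  let ?F = "\<lambda>j. f (Sq (r - j) (Sq j (monomial a)))"
  have s: "s\<^sup>2 + s = s * [:1, 1:]" and s1: "1 + s = [:1, 1:]"
    by (simp_all add: s_def power2_eq_square monom_altdef algebra_simps one_pCons)
  (* Between the two ends the left factor is a square of degree strictly between 0 and r. *)
  have ends: "(\<Sum>j\<le>r. ?F j * c j) = ?F 0 * c 0 + ?F r * c r" for c
  proof -
    have "(\<Sum>j\<le>r. ?F j * c j) = (\<Sum>j\<in>{0, r}. ?F j * c j)"
      by (rule sum.mono_neutral_right) (auto intro!: lower)
    then show ?thesis
      using \<open>r > 0\<close> by simp
  qed
  have "(\<Sum>j\<le>r. ?F j * coeff ((s\<^sup>2 + s) ^ (r - j) * 1 ^ j) k) =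
      (\<Sum>j\<le>r. ?F j * coeff ((1 + s) ^ (r - j) * (s\<^sup>2) ^ j) k)"
    using arg_cong[OF bullett_macdonald_one_variable[OF f, of r a s], of "\<lambda>p. coeff p k"]
    by (simp add: coeff_sum)
  moreover have "coeff ((s\<^sup>2 + s) ^ r) k = 0"
    unfolding s power_mult_distrib using k by (simp only: s_def monom_power coeff_monom_mult) simp
  moreover have "coeff ((1 + s) ^ r) k = 1"
    using k by (simp add: s1 coeff_one_plus_linear_power bit_of_nat_odd)
  moreover have "coeff ((s\<^sup>2) ^ r) k = 0"
    using k by (simp add: s_def monom_power)
  ultimately show ?thesis
    using k by (simp add: ends Sq_0)
qed

lemma vanish_on_Sq_if_vanish_on_Sq_powers_of_two:
  assumes f: "functional f" and "\<And>t p. f (Sq (2 ^ t) p) = 0" and "r > 0"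
  shows "f (Sq r p) = 0"
  using \<open>r > 0\<close>
proof (induction r arbitrary: p rule: less_induct)
  case (less r)
  show ?case
  proof (cases "\<exists>t. r = 2 ^ t")
    case False
    then have "f (Sq r (monomial a)) = 0" for a
      using less by (intro Sq_decomposable[OF f]) auto
    then show ?thesis
      using linear_expand[OF functional_Sq[OF f], of r p] by simp
  qed (use assms(2) in auto)
qed


section \<open>Functionals killed by the squares and the hit polynomials\<close>

text \<open>
  The operators act on such a functional through the augmentation of the Steenrod algebra, which has
  only the values \<open>0\<close> and \<open>1\<close>.  This is what handles a left factor from the whole algebra in the
  augmentation ideal.
\<close>
lemma steenrod_fixes_or_kills:
  assumes f: "functional f" and kill: "\<And>r p. r > 0 \<Longrightarrow> f (Sq r p) = 0" and "\<theta> \<in> steenrod"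
  shows "(\<forall>p. f (\<theta> p) = f p) \<or> (\<forall>p. f (\<theta> p) = 0)"
  using assms(3)
proof induction
  case (Sq r)
  show ?case
    using kill by (cases "r = 0") (auto simp: Sq_0)
next
  case (add \<theta> \<eta>)
  interpret Vector_Spaces.linear pscale "(*)" f by fact
  have "x + x = 0" for x :: bit
    by (simp only: mult_2[symmetric] bit_2_eq_0 mult_zero_left)
  with add.IH show ?case
    by (auto simp: local.add)
qed auto

lemma vanish_on_hit:
  assumes f: "functional f" and kill: "\<And>r p. r > 0 \<Longrightarrow> f (Sq r p) = 0" and "p \<in> hit"
  shows "f p = 0"
proof -
  interpret Vector_Spaces.linear pscale "(*)" f by fact
  have plus: "f (\<theta> p) = 0" if "\<theta> \<in> steenrod_plus" for \<theta> p
    using that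
  proof (induction arbitrary: p)
    case (left \<theta> \<eta>)
    then show ?case
      using steenrod_fixes_or_kills[OF f kill left.hyps(1)] by auto
  qed (auto simp: kill local.add)
  show ?thesis
    using assms(3) unfolding hit_def
  proof (induction rule: pol.span_induct)
    case base
    show ?case
      by (rule pol.subspaceI) (simp_all add: zero local.add scale)
  next
    case (step p)
    then show ?case
      using plus by blast
  qed
qed


section \<open>The leading variable and the rows of the matrix\<close>

lemma
  fixes e :: "'n::{finite,linorder} expo"
  assumes "e \<noteq> 0"
  shows lookup_lead_pos: "lookup e (lead e) > 0"
    and lookup_less_lead: "i < lead e \<Longrightarrow> lookup e i = 0"
proof -
  have "{i. lookup e i > 0} \<noteq> {}"
    using assms by (auto intro: poly_mapping_eqI)
  from Min_in[OF _ this] show "lookup e (lead e) > 0"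
    by (simp add: lead_def)
  show "lookup e i = 0" if "i < lead e"
    using Min_le[of "{i. lookup e i > 0}" i] that by (fastforce simp: lead_def)
qed

lemma lead_eqI:
  fixes e :: "'n::{finite,linorder} expo"
  assumes "lookup e i > 0" and "\<And>j. j < i \<Longrightarrow> lookup e j = 0"
  shows "lead e = i"
proof -
  have "e \<noteq> 0"
    using assms(1) by auto
  then show ?thesis
    using lookup_lead_pos[of e] lookup_less_lead[of e i] assms
    by (metis less_numeral_extra(3) linorder_neqE)
qed

lemma lookup_eps: "lookup (eps j) i = of_bool (i = j)"
  by (auto simp: eps_def lookup_single when_def)

lemma deg_eps: "deg (eps j) = 1"
  by (simp add: deg_def lookup_eps)

lemma inj_eps: "inj eps"
proof (rule injI)
  fix i j :: 'a
  assume "eps i = eps j"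
  then have "lookup (eps i) i = lookup (eps j) i"
    by simp
  then show "i = j"
    by (cases "i = j") (simp_all add: lookup_eps)
qed

lemma deg_eq_1_iff: "deg b = 1 \<longleftrightarrow> b \<in> range eps"
proof
  assume b: "deg b = 1"
  then obtain j where j: "lookup b j = 1" and z: "\<And>i. i \<noteq> j \<Longrightarrow> lookup b i = 0"
    using sum_eq_1_iff[of UNIV "lookup b"] by (auto simp: deg_def)
  then have "b = eps j"
    by (intro poly_mapping_eqI) (simp add: lookup_eps)
  then show "b \<in> range eps"
    by blast
qed (auto simp: deg_eps)

lemma mbinom_eps: "mbinom a (eps j) = lookup a j"
proof -
  have "mbinom a (eps j) = (\<Prod>i\<in>UNIV. if i = j then lookup a i else 1)"
    unfolding mbinom_def by (rule prod.cong) (auto simp: lookup_eps)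
  then show ?thesis
    by simp
qed

lemma coeff_Sq_1_monomial:
  "dual_mon f (Sq 1 (monomial a)) = (\<Sum>j\<in>UNIV. of_nat (lookup a j) * of_bool (a + eps j = f))"
proof -
  have "dual_mon f (Sq 1 (monomial a)) =
      (\<Sum>b\<in>range eps. of_nat (mbinom a b) * of_bool (a + b = f))"
    by (simp only: functional_Sq_monomial[OF functional_dual_mon] dual_mon_monomial deg_eq_1_iff
        Collect_mem_eq)
  also have "\<dots> = (\<Sum>j\<in>UNIV. of_nat (lookup a j) * of_bool (a + eps j = f))"
    by (simp add: sum.reindex[OF inj_eps] mbinom_eps)
  finally show ?thesis .
qed

lemma rows_lead:
  assumes "e \<in> rows d"
  shows "e \<noteq> 0" "deg e = d" "odd (lookup e (lead e))"
  using assms by (auto simp: rows_def)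

lemma sum_fun_apply: "(\<Sum>j\<in>A. g j) p = (\<Sum>j\<in>A. g j p)"
  for g :: "'a \<Rightarrow> 'b \<Rightarrow> 'c::comm_monoid_add"
  by (induction A rule: infinite_finite_induct) auto

lemma phi_apply: "phi e p = lookup p e +
    (\<Sum>j\<in>{j. lead e < j \<and> even (lookup e j) \<and> lookup e j > 0}. lookup p (e + eps (lead e) - eps j))"
  by (simp add: phi_def dual_mon_def sum_fun_apply)

lemma functional_phi: "functional (phi e)"
  unfolding Vector_Spaces.linear_iff
  by (intro conjI pol.vector_space_axioms vector_space_bit)
    (simp_all add: phi_apply lookup_add sum.distrib sum_distrib_left distrib_left)

text \<open>
  Write \<open>f = e + \<epsilon>\<^sub>i\<close> with \<open>i\<close> the leading variable.  Under \<open>Sq\<^sup>1\<close>, the monomial \<open>x\<^sup>f\<close> arises from \<open>x\<^bsup>f-\<epsilon>\<^sub>j\<^esup>\<close>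
  with weight \<open>f\<^sub>j - 1\<close>, so exactly the \<open>j\<close> with \<open>f\<^sub>j\<close> even and positive count.  Among them is \<open>i\<close>,
  since \<open>e\<^sub>i\<close> is odd, and it accounts for the term \<open>(x\<^sup>e)\<^sup>*\<close>; the others lie beyond \<open>i\<close>.
\<close>
lemma phi_eq_coeff_Sq_1:
  fixes e :: "'n::{finite,linorder} expo"
  assumes "e \<in> rows d"
  shows "phi e = dual_mon (e + eps (lead e)) \<circ> Sq 1"
proof (rule linear_eqI[OF functional_phi functional_Sq[OF functional_dual_mon]])
  fix a :: "'n expo"
  note e = rows_lead[OF assms]
  define i where "i = lead e"
  define f where "f = e + eps i"
  define J where "J = {j. i < j \<and> even (lookup e j) \<and> lookup e j > 0}"
  have J: "insert i J = {j. even (lookup f j) \<and> lookup f j > 0}"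
    using e(3) lookup_less_lead[OF e(1)]
    by (auto simp: J_def f_def i_def lookup_add lookup_eps not_less_iff_gr_or_eq) (metis linorder_neqE less_irrefl)
  have add_eq: "a + eps j = f \<longleftrightarrow> a = f - eps j" if "lookup f j > 0" for j
  proof
    assume "a = f - eps j"
    then show "a + eps j = f"
      using that by (intro poly_mapping_eqI) (auto simp: lookup_add lookup_minus lookup_eps)
  qed auto
  have "phi e (monomial a) = (\<Sum>j\<in>insert i J. of_bool (a = f - eps j))"
    by (simp add: phi_def sum_fun_apply dual_mon_monomial J_def i_def f_def)
  also have "\<dots> = (\<Sum>j\<in>UNIV. of_nat (lookup a j) * of_bool (a + eps j = f))"
  proof (rule sum.mono_neutral_cong_left; (intro ballI)?)
    fix j assume "j \<in> insert i J"
    then show "of_bool (a = f - eps j) = (of_nat (lookup a j) * of_bool (a + eps j = f) :: bit)"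
      unfolding J by (auto simp: add_eq lookup_minus lookup_eps bit_of_nat_odd)
  next
    fix j assume "j \<in> UNIV - insert i J"
    then show "of_nat (lookup a j) * of_bool (a + eps j = f) = (0 :: bit)"
      unfolding J by (auto simp: lookup_add lookup_eps bit_of_nat_even)
  qed auto
  finally show "phi e (monomial a) = (dual_mon (e + eps (lead e)) \<circ> Sq 1) (monomial a)"
    by (simp only: comp_apply coeff_Sq_1_monomial f_def i_def)
qed

lemma phi_monomial:
  assumes "e \<in> rows d"
  shows "phi e (monomial a) = (\<Sum>j\<in>UNIV. of_nat (lookup a j) * of_bool (a + eps j = e + eps (lead e)))"
  by (simp only: phi_eq_coeff_Sq_1[OF assms] comp_apply coeff_Sq_1_monomial)

lemma phi_monomial_wrong_deg:
  assumes "e \<in> rows d" and "deg a \<noteq> d"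
  shows "phi e (monomial a) = 0"
proof -
  have "a + eps j \<noteq> e + eps (lead e)" for j
  proof
    assume "a + eps j = e + eps (lead e)"
    then have "deg (a + eps j) = deg (e + eps (lead e))"
      by simp
    then show False
      using assms rows_lead(2)[OF assms(1)] by (simp add: deg_add deg_eps)
  qed
  then show ?thesis
    by (simp add: phi_monomial[OF assms(1)])
qed

text \<open>
  Only \<open>x\<^bsup>e+\<epsilon>\<^sub>i\<^esup>\<close> is mapped to \<open>x\<^sup>e\<close>: lowering an even positive leading exponent leaves it odd, hence
  nonzero, so the leading variable of the preimage must be that of \<open>e\<close>.
\<close>
lemma coeff_hmap:
  fixes e :: "'n::{finite,linorder} expo"
  assumes "e \<in> rows d"
  shows "lookup (hmap p) e = lookup p (e + eps (lead e))"
proof -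
  note e = rows_lead[OF assms]
  have "dual_mon e \<circ> hmap = dual_mon (e + eps (lead e))"
  proof (rule linear_eqI[OF _ functional_dual_mon])
    show "functional (dual_mon e \<circ> hmap)"
      unfolding hmap_def by (rule Vector_Spaces.linear_compose[OF linear_lin_ext functional_dual_mon])
    fix a :: "'n expo"
    have "a \<noteq> 0 \<and> even (lookup a (lead a)) \<and> a - eps (lead a) = e \<longleftrightarrow> a = e + eps (lead e)"
    proof
      assume a: "a \<noteq> 0 \<and> even (lookup a (lead a)) \<and> a - eps (lead a) = e"
      define i where "i = lead a"
      have i: "lookup a i > 0" "even (lookup a i)" "\<And>j. j < i \<Longrightarrow> lookup a j = 0"
        using a lookup_lead_pos[of a] lookup_less_lead[of a] by (auto simp: i_def)
      have ai: "a = e + eps i"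
        using a i(1) by (intro poly_mapping_eqI) (auto simp: lookup_add lookup_minus lookup_eps i_def)
      have "lead e = i"
        using i unfolding ai by (intro lead_eqI) (auto simp: lookup_add lookup_eps elim!: oddE split: if_splits intro!: Nat.gr0I)
      then show "a = e + eps (lead e)"
        using ai by simp
    next
      assume a: "a = e + eps (lead e)"
      have "lead a = lead e"
        using e lookup_lead_pos[OF e(1)] lookup_less_lead[OF e(1)] unfolding a
        by (intro lead_eqI) (auto simp: lookup_add lookup_eps)
      moreover have "lookup a (lead e) \<noteq> 0"
        by (simp add: a lookup_add lookup_eps)
      then have "a \<noteq> 0"
        by auto
      ultimately show "a \<noteq> 0 \<and> even (lookup a (lead a)) \<and> a - eps (lead a) = e"
        using e(3) by (simp add: lookup_add lookup_eps) (simp add: a lookup_add lookup_eps)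
    qed
    moreover have "(dual_mon e \<circ> hmap) (monomial a) =
        of_bool (a \<noteq> 0 \<and> even (lookup a (lead a)) \<and> a - eps (lead a) = e)"
      by (auto simp: hmap_def lin_ext_monomial dual_mon_monomial) (auto simp: dual_mon_def)
    ultimately show "(dual_mon e \<circ> hmap) (monomial a) = dual_mon (e + eps (lead e)) (monomial a)"
      by (simp only: dual_mon_monomial)
  qed
  from fun_cong[OF this, of p] show ?thesis
    by (simp add: dual_mon_def)
qed

lemma Mbar_eq_phi:
  assumes "e \<in> rows d"
  shows "Mbar e (t, g) = phi e (Sq (2 ^ t) (monomial g))"
  by (simp add: Mbar_def hSq1_def coeff_hmap[OF assms] phi_eq_coeff_Sq_1[OF assms] dual_mon_def)

lemma zero_rows_subset: "zero_rows d \<subseteq> rows d"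
  by (auto simp: zero_rows_def)

lemma finite_zero_rows: "finite (zero_rows d)"
  by (rule finite_subset[OF _ finite_deg_eq[of d]]) (auto simp: zero_rows_def rows_def)

text \<open>
  Squares of the form \<open>Sq\<^bsup>2^t\<^esup>\<close> suffice.  For \<open>t \<ge> 1\<close> and a monomial of degree \<open>d - 2\<^sup>t\<close> the value is
  an entry of the zero row, and in all other degrees \<open>\<phi>\<^sub>e\<close> vanishes; for \<open>t = 0\<close> the
  value is a coefficient of \<open>Sq\<^sup>1Sq\<^sup>1 = 0\<close>.
\<close>
lemma phi_Sq_eq_0:
  fixes e :: "'n::{finite,linorder} expo"
  assumes "e \<in> zero_rows d" and "r > 0"
  shows "phi e (Sq r p) = 0"
proof (rule vanish_on_Sq_if_vanish_on_Sq_powers_of_two[OF functional_phi _ assms(2)])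
  fix t and p :: "'n pol"
  have e: "e \<in> rows d"
    using assms(1) zero_rows_subset by blast
  have "phi e (Sq (2 ^ t) (monomial g)) = 0" for g :: "'n expo"
  proof (cases "t = 0 \<or> deg g + 2 ^ t \<noteq> d")
    case False
    then have "(t, g) \<in> columns d"
      by (auto simp: columns_def)
    then show ?thesis
      using assms(1) Mbar_eq_phi[OF e, of t g] by (auto simp: zero_rows_def)
  next
    case True
    then show ?thesis
    proof
      assume "t = 0"
      then show ?thesis
        using Sq_1_Sq_1[OF functional_dual_mon] by (simp add: phi_eq_coeff_Sq_1[OF e])
    next
      assume "deg g + 2 ^ t \<noteq> d"
      then show ?thesis
        by (simp add: functional_Sq_monomial[OF functional_phi] phi_monomial_wrong_deg[OF e] deg_add)
    qed
  qed
  then show "phi e (Sq (2 ^ t) p) = 0"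
    using linear_expand[OF functional_Sq[OF functional_phi], of e "2 ^ t" p] by simp
qed

lemma phi_in_Sq_kernel:
  assumes "e \<in> zero_rows d"
  shows "phi e \<in> Sq_kernel d"
proof -
  have e: "e \<in> rows d"
    using assms zero_rows_subset by blast
  have "phi e p = 0" if "n \<noteq> d" "p \<in> pol_deg n" for n p
    using linear_expand[OF functional_phi, of e p] phi_monomial_wrong_deg[OF e] that
    by (simp add: pol_deg_def)
  then show ?thesis
    using phi_Sq_eq_0[OF assms] functional_phi
    by (auto simp: Sq_kernel_def dual_deg_def Sq_dual_def fun_eq_iff)
qed


section \<open>Linear independence\<close>

text \<open>
  In both applications \<open>W i\<close> is the set of vectors on which the coordinate dual to \<open>v i\<close> vanishes.
  Asking for subspaces rather than functionals avoids lifting functionals to the quotient.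
\<close>
lemma (in vector_space) independent_if_separated:
  assumes "\<And>i. i \<in> I \<Longrightarrow> subspace (W i)" and "\<And>i. i \<in> I \<Longrightarrow> v i \<notin> W i"
    and "\<And>i j. i \<in> I \<Longrightarrow> j \<in> I \<Longrightarrow> i \<noteq> j \<Longrightarrow> v j \<in> W i"
  shows "inj_on v I" and "independent (v ` I)"
proof -
  show "inj_on v I"
    using assms(2,3) by (metis inj_onI)
  show "independent (v ` I)"
  proof
    assume "dependent (v ` I)"
    then obtain i where i: "i \<in> I" "v i \<in> span (v ` I - {v i})"
      by (auto simp: dependent_def)
    have "v ` I - {v i} \<subseteq> W i"
      using assms(3) i(1) by auto
    then have "span (v ` I - {v i}) \<subseteq> W i"
      by (rule span_minimal) (rule assms(1)[OF i(1)])
    then show False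
      using assms(2) i by blast
  qed
qed

text \<open>
  If \<open>e' \<noteq> e\<close> occurred in \<open>\<phi>\<^sub>e\<close>, then \<open>e' + \<epsilon>\<^sub>j = e + \<epsilon>\<^sub>i\<close> with \<open>j \<noteq> i\<close>, so \<open>e'\<close> would lead with the even
  exponent \<open>e\<^sub>i + 1\<close> and could not be a row.
\<close>
lemma phi_row_monomial:
  fixes e e' :: "'n::{finite,linorder} expo"
  assumes "e \<in> rows d" and "e' \<in> rows d'"
  shows "phi e (monomial e') = of_bool (e = e')"
proof (cases "e = e'")
  case True
  have "phi e (monomial e') = (\<Sum>j\<in>UNIV. if j = lead e then of_nat (lookup e j) else 0)"
    unfolding phi_monomial[OF assms(1)] using inj_eps True
    by (intro sum.cong) (auto dest: injD)
  then show ?thesis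
    using True rows_lead(3)[OF assms(1)] by (simp add: bit_of_nat_odd)
next
  case False
  note e = rows_lead[OF assms(1)] and e' = rows_lead[OF assms(2)]
  have "e' + eps j \<noteq> e + eps (lead e)" for j
  proof
    assume eq: "e' + eps j = e + eps (lead e)"
    then have "j \<noteq> lead e"
      using False by auto
    have lookup_e': "lookup e' i + of_bool (i = j) = lookup e i + of_bool (i = lead e)" for i
      using arg_cong[OF eq, of "\<lambda>p. lookup p i"] by (simp add: lookup_add lookup_eps)
    have "lead e' = lead e"
    proof (rule lead_eqI)
      show "lookup e' (lead e) > 0"
        using lookup_e'[of "lead e"] \<open>j \<noteq> lead e\<close> by simp
      show "lookup e' i = 0" if "i < lead e" for i
        using lookup_e'[of i] lookup_less_lead[OF e(1) that] that
        by (auto simp: of_bool_def split: if_splits)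
    qed
    then show False
      using lookup_e'[of "lead e"] e(3) e'(3) \<open>j \<noteq> lead e\<close> by auto
  qed
  then show ?thesis
    using False by (simp add: phi_monomial[OF assms(1)])
qed

lemma phi_independent:
  "inj_on phi (rows d :: 'n::{finite,linorder} expo set)"
  "fun_pol.independent (phi ` (rows d :: 'n expo set))"
proof -
  let ?W = "\<lambda>e. {f :: 'n pol \<Rightarrow> bit. f (monomial e) = 0}"
  have W: "fun_pol.subspace (?W e)" for e
    by (auto simp: fun_pol.subspace_def fscale_def)
  show "inj_on phi (rows d :: 'n expo set)" "fun_pol.independent (phi ` (rows d :: 'n expo set))"
    by (rule fun_pol.independent_if_separated[where W = ?W]; auto simp: W phi_row_monomial)+
qed

lemma finite_pol_deg: "finite (pol_deg d :: 'n::finite pol set)"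
proof (rule finite_subset)
  show "finite ((\<lambda>A. \<Sum>e\<in>A. monomial e) ` Pow {e :: 'n expo. deg e = d})"
    by (simp add: finite_deg_eq)
  show "(pol_deg d :: 'n pol set) \<subseteq> (\<lambda>A. \<Sum>e\<in>A. monomial e) ` Pow {e. deg e = d}"
  proof
    fix p :: "'n pol" assume "p \<in> pol_deg d"
    moreover have "p = (\<Sum>e\<in>keys p. monomial e)"
      by (subst pol_eq_sum_monomials) (auto intro!: sum.cong simp: in_keys_iff)
    ultimately show "p \<in> (\<lambda>A. \<Sum>e\<in>A. monomial e) ` Pow {e. deg e = d}"
      by (intro image_eqI) (auto simp: pol_deg_def)
  qed
qed

lemma QP_class_eq_iff: "QP_class p = QP_class q \<longleftrightarrow> p - q \<in> hit"
  by (rule QP.abs_eq_iff)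

text \<open>
  For a zero row \<open>e\<close> the functional \<open>\<phi>\<^sub>e\<close> vanishes on the hit polynomials, so it is well defined on
  classes and separates the class of \<open>x\<^sup>e\<close> from those of the other zero rows.
\<close>
lemma QP_monomials_independent:
  fixes d :: nat
  defines "Z \<equiv> zero_rows d :: 'n::{finite,linorder} expo set"
  shows "inj_on (\<lambda>e. QP_class (monomial e)) Z"
    and "QP.independent ((\<lambda>e. QP_class (monomial e)) ` Z)"
proof -
  let ?W = "\<lambda>e :: 'n expo. QP_class ` {p. phi e p = 0}"
  have lin: "phi e (p + q) = phi e p + phi e q" "phi e (p - q) = phi e p - phi e q"
    "phi e (pscale c p) = c * phi e p" "phi e 0 = 0" for e :: "'n expo" and p q c
  proof -
    interpret Vector_Spaces.linear pscale "(*)" "phi e" by (rule functional_phi)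
    show "phi e (p + q) = phi e p + phi e q" "phi e (p - q) = phi e p - phi e q"
      "phi e (pscale c p) = c * phi e p" "phi e 0 = 0"
      by (rule add diff scale zero)+
  qed
  have W: "QP.subspace (?W e)" for e
    unfolding QP.subspace_def
    by (auto simp: zero_QP_def plus_QP.abs_eq qscale.abs_eq lin intro!: imageI)
  have notin: "QP_class (monomial e) \<notin> ?W e" if "e \<in> Z" for e
  proof
    assume "QP_class (monomial e) \<in> ?W e"
    then obtain p where "phi e p = 0" and "monomial e - p \<in> hit"
      by (auto simp: QP_class_eq_iff)
    moreover from this have "phi e (monomial e - p) = 0"
      using vanish_on_hit[OF functional_phi phi_Sq_eq_0[OF that[unfolded Z_def]]] by blast
    ultimately show False
      using that zero_rows_subset[of d] phi_row_monomial[of e d e d] by (auto simp: lin Z_def)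
  qed
  have isin: "QP_class (monomial e') \<in> ?W e" if "e \<in> Z" "e' \<in> Z" "e \<noteq> e'" for e e'
    using that zero_rows_subset[of d] phi_row_monomial[of e d e' d] by (auto simp: Z_def)
  show "inj_on (\<lambda>e. QP_class (monomial e)) Z"
    by (rule QP.independent_if_separated(1)[where W = ?W, OF W notin isin])
  show "QP.independent ((\<lambda>e. QP_class (monomial e)) ` Z)"
    by (rule QP.independent_if_separated(2)[where W = ?W, OF W notin isin])
qed

text \<open>
  The independent classes extend to a basis of the degree \<open>d\<close> part, which is a finite set because
  the polynomials of degree \<open>d\<close> over the field with two elements are finite in number.
\<close>
lemma card_zero_rows_le_dim:
  "card (zero_rows d :: 'n::{finite,linorder} expo set) \<le> QP.dim (QP_deg d :: 'n QP set)"
proof -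
  let ?v = "\<lambda>e :: 'n expo. QP_class (monomial e)"
  have "?v ` zero_rows d \<subseteq> QP_deg d"
    by (auto simp: QP_deg_def pol_deg_def monomial_def zero_rows_def rows_def)
  then obtain B where B: "?v ` zero_rows d \<subseteq> B" "B \<subseteq> QP_deg d" "QP.independent B"
      "QP_deg d \<subseteq> QP.span B"
    using QP.maximal_independent_subset_extend QP_monomials_independent(2) by metis
  have "finite B"
    using B(2) finite_pol_deg[of d] unfolding QP_deg_def by (metis finite_imageI finite_subset)
  have "card (zero_rows d :: 'n expo set) = card (?v ` zero_rows d)"
    using card_image[OF QP_monomials_independent(1)] by metis
  also have "\<dots> \<le> card B"
    using B(1) \<open>finite B\<close> by (rule card_mono[rotated])
  also have "\<dots> = QP.dim (QP_deg d :: 'n QP set)"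
    using B by (intro QP.basis_card_eq_dim)
  finally show ?thesis .
qed


section \<open>Spikes\<close>

lemma spike_is_row:
  fixes b :: "'n::{finite,linorder} expo"
  assumes "b \<in> spikes d" and "d > 0"
  shows "b \<in> rows d" and "phi b = dual_mon b"
proof -
  have odd: "odd (lookup b i)" if "lookup b i > 0" for i
  proof -
    obtain m where "lookup b i = 2 ^ m - 1"
      using assms(1) by (auto simp: spikes_def)
    then show ?thesis
      using that by (cases m) auto
  qed
  have "deg b = d"
    using assms(1) by (simp add: spikes_def)
  moreover from this have "b \<noteq> 0"
    using assms(2) deg_eq_0_iff[of b] by auto
  ultimately show "b \<in> rows d"
    using odd lookup_lead_pos by (auto simp: rows_def)
  have none: "{j. lead b < j \<and> even (lookup b j) \<and> lookup b j > 0} = {}"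
    using odd by auto
  show "phi b = dual_mon b"
    unfolding phi_def none by simp
qed

text \<open>
  The coefficient of \<open>x\<^sup>b\<close> in \<open>Sq\<^sup>r(x\<^sup>g)\<close> is \<open>\<Prod>\<^sub>i (g\<^sub>i choose c\<^sub>i)\<close> with \<open>g + c = b\<close>; any \<open>i\<close> with
  \<open>c\<^sub>i > 0\<close>, such as the leading variable of \<open>c\<close>, contributes an even factor.
\<close>
lemma spikes_subset_zero_rows:
  assumes "d > 0"
  shows "spikes d \<subseteq> (zero_rows d :: 'n::{finite,linorder} expo set)"
proof
  fix b :: "'n expo" assume b: "b \<in> spikes d"
  note row = spike_is_row[OF b assms]
  have "Mbar b (t, g) = 0" for t and g :: "'n expo"
  proof -
    have "of_nat (mbinom g c) * dual_mon b (monomial (g + c)) = 0" if "deg c = 2 ^ t" for c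
    proof (cases "g + c = b")
      case True
      define i where "i = lead c"
      have "c \<noteq> 0"
        using that deg_eq_0_iff[of c] by auto
      then have i: "lookup c i > 0"
        unfolding i_def by (rule lookup_lead_pos)
      obtain m where "lookup g i + lookup c i = 2 ^ m - 1"
        using b True by (auto simp: spikes_def simp flip: lookup_add)
      then have "even (lookup g i choose lookup c i)"
        using i by (rule even_choose_if_add_eq_mersenne)
      then have "even (mbinom g c)"
        unfolding mbinom_def by (metis UNIV_I dvd_prodI dvd_trans finite)
      then show ?thesis
        by (simp add: bit_of_nat_even)
    qed (simp add: dual_mon_monomial)
    then show ?thesis
      unfolding Mbar_eq_phi[OF row(1)] row(2) functional_Sq_monomial[OF functional_dual_mon]
      by (intro sum.neutral ballI) blast
  qed
  then show "b \<in> zero_rows d"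
    using row(1) by (auto simp: zero_rows_def)
qed


section \<open>Zero rows, the kernel of the dual squares and spikes\<close>

theorem proposition5p2:
  fixes d :: nat
  assumes "d > 0"
  shows "(\<forall>e \<in> (zero_rows d :: 'n::{finite,linorder} expo set). phi e \<in> Sq_kernel d) \<and>
    inj_on phi (zero_rows d :: 'n expo set) \<and>
    fun_pol.independent (phi ` (zero_rows d :: 'n expo set)) \<and>
    dual_mon ` (spikes d :: 'n expo set) \<subseteq> phi ` zero_rows d \<and>
    QP.dim (QP_deg d :: 'n QP set) \<ge> card (zero_rows d :: 'n expo set) \<and>
    card (zero_rows d :: 'n expo set) \<ge> card (spikes d :: 'n expo set)"
proof (intro conjI ballI)
  let ?Z = "zero_rows d :: 'n expo set"
  show "phi e \<in> Sq_kernel d" if "e \<in> ?Z" for e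
    using that by (rule phi_in_Sq_kernel)
  show "inj_on phi ?Z"
    using phi_independent(1) zero_rows_subset by (rule inj_on_subset)
  show "fun_pol.independent (phi ` ?Z)"
    using phi_independent(2) image_mono[OF zero_rows_subset] by (rule fun_pol.independent_mono)
  show "dual_mon ` spikes d \<subseteq> phi ` ?Z"
  proof (rule image_subsetI)
    fix b :: "'n expo" assume b: "b \<in> spikes d"
    then show "dual_mon b \<in> phi ` ?Z"
      using spikes_subset_zero_rows[OF assms] spike_is_row(2)[OF b assms] by (metis image_eqI subsetD)
  qed
  show "card ?Z \<le> QP.dim (QP_deg d :: 'n QP set)"
    by (rule card_zero_rows_le_dim)
  show "card (spikes d :: 'n expo set) \<le> card ?Z"
    by (rule card_mono[OF finite_zero_rows spikes_subset_zero_rows[OF assms]])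
qed

end
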